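(* Let $k$ be a positive integer. Then for all sufficiently large $n$ (with a threshold that may depend on $k$), $$R(C_n,kK_2,kK_2)=n+2k-2.$$
   Context: All graphs are finite, simple and undirected. $C_n$ denotes the cycle on $n$ vertices and $kK_2$ the disjoint union of $k$ edges (a matching of size $k$). For graphs $G_1,\ldots,G_r$, the multicolor Ramsey number $R(G_1,\ldots,G_r)$ is the smallest integer $n$ such that every coloring of the edges of the complete graph $K_n$ with $r$ colors contains a monochromatic copy of $G_i$ in color $i$ for some $1\le i\le r$ (a copy means a not necessarily induced subgraph). *)

theory Defs
  imports "HOL-Library.Ramsey"
begin

text \<open>A graph is a pair of a vertex set and a set of edges, each edge being a two-element set of
  vertices.\<close>

type_synonym 'a graph = "'a set \<times> 'a set set"

abbreviation verts :: "'a graph \<Rightarrow> 'a set" where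
  "verts G \<equiv> fst G"

abbreviation edges :: "'a graph \<Rightarrow> 'a set set" where
  "edges G \<equiv> snd G"

definition simple_graph :: "'a graph \<Rightarrow> bool" where
  "simple_graph G \<longleftrightarrow> finite (verts G) \<and> edges G \<subseteq> [verts G]\<^bsup>2\<^esup>"

definition complete_graph :: "nat \<Rightarrow> nat graph" where
  "complete_graph n = ({..<n}, [{..<n}]\<^bsup>2\<^esup>)"

text \<open>Meaningful only for \<open>n \<ge> 3\<close>: the formula gives a loop for \<open>n = 1\<close> and a single edge for
  \<open>n = 2\<close>.\<close>

definition cycle_graph :: "nat \<Rightarrow> nat graph" where
  "cycle_graph n = ({..<n}, {{i, (i + 1) mod n} | i. i < n})"

definition matching_graph :: "nat \<Rightarrow> nat graph" where
  "matching_graph k = ({..<2 * k}, {{2 * i, 2 * i + 1} | i. i < k})"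

definition contains_copy :: "'a graph \<Rightarrow> 'b graph \<Rightarrow> bool" where
  "contains_copy G H \<longleftrightarrow>
     (\<exists>f. inj_on f (verts H) \<and> f ` verts H \<subseteq> verts G \<and> (\<forall>e \<in> edges H. f ` e \<in> edges G))"

definition colour_class :: "'a graph \<Rightarrow> ('a set \<Rightarrow> nat) \<Rightarrow> nat \<Rightarrow> 'a graph" where
  "colour_class G c i = (verts G, {e \<in> edges G. c e = i})"

text \<open>With \<open>r = length Gs\<close>, the colours are \<open>0, \<dots>, r - 1\<close>, and the graph belonging to colour \<open>i\<close>
  is \<open>Gs ! i\<close>.\<close>

definition ramsey_arrows :: "nat \<Rightarrow> 'a graph list \<Rightarrow> bool" where
  "ramsey_arrows n Gs \<longleftrightarrow>
     (\<forall>c \<in> edges (complete_graph n) \<rightarrow> {..<length Gs}.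
        \<exists>i < length Gs. contains_copy (colour_class (complete_graph n) c i) (Gs ! i))"

definition ramsey_number :: "'a graph list \<Rightarrow> nat" where
  "ramsey_number Gs = (LEAST n. ramsey_arrows n Gs)"

lemma simple_graph_complete_graph: "simple_graph (complete_graph n)"
  by (simp add: simple_graph_def complete_graph_def)

lemma simple_graph_cycle_graph:
  assumes "n \<ge> 3"
  shows "simple_graph (cycle_graph n)"
proof -
  have "i \<noteq> Suc i mod n" if "i < n" for i
    using that assms by (cases "Suc i = n") auto
  with assms show ?thesis
    by (auto simp: simple_graph_def cycle_graph_def)
qed

lemma simple_graph_matching_graph: "simple_graph (matching_graph k)"
  by (auto simp: simple_graph_def matching_graph_def)

text \<open>By Ramsey's theorem the set minimised in \<open>ramsey_number\<close> is nonempty for simple graphs.\<close>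

lemma ramsey_arrows_exists:
  assumes simple: "\<And>G. G \<in> set Gs \<Longrightarrow> simple_graph G"
  shows "\<exists>n. ramsey_arrows n Gs"
proof -
  obtain N :: nat where N: "partn_lst {..<N} (map (\<lambda>G. card (verts G)) Gs) 2"
    using ramsey_full by blast
  have "ramsey_arrows N Gs"
    unfolding ramsey_arrows_def
  proof
    fix c assume "c \<in> edges (complete_graph N) \<rightarrow> {..<length Gs}"
    then have "c \<in> [{..<N}]\<^bsup>2\<^esup> \<rightarrow> {..<length Gs}"
      by (simp add: complete_graph_def)
    then obtain i H where i: "i < length Gs" and H: "H \<in> [{..<N}]\<^bsup>card (verts (Gs ! i))\<^esup>"
      and mono: "c ` [H]\<^bsup>2\<^esup> \<subseteq> {i}"
      by (rule partn_lstE [OF N]) auto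
    have G: "finite (verts (Gs ! i))" "edges (Gs ! i) \<subseteq> [verts (Gs ! i)]\<^bsup>2\<^esup>"
      using simple [OF nth_mem [OF i]] by (auto simp: simple_graph_def)
    from H have "finite H" "card (verts (Gs ! i)) = card H" and HN: "H \<subseteq> {..<N}"
      by (auto simp: nsets_def)
    with G obtain f where f: "bij_betw f (verts (Gs ! i)) H"
      using finite_same_card_bij by blast
    have "f ` e \<in> [H]\<^bsup>2\<^esup>" if "e \<in> edges (Gs ! i)" for e
      using bij_betw_nsets [OF f, of 2] that G by (auto simp: bij_betw_def)
    then have "f ` e \<in> [{..<N}]\<^bsup>2\<^esup> \<and> c (f ` e) = i" if "e \<in> edges (Gs ! i)" for e
      using that mono nsets_mono [OF HN] by blast
    with f HN have "contains_copy (colour_class (complete_graph N) c i) (Gs ! i)"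
      unfolding contains_copy_def colour_class_def complete_graph_def
      by (intro exI [of _ f]) (auto simp: bij_betw_def)
    with i show "\<exists>i < length Gs. contains_copy (colour_class (complete_graph N) c i) (Gs ! i)"
      by blast
  qed
  then show ?thesis ..
qed

end

theory Submission
  imports Defs "HOL-Library.Multiset"
begin

text \<open>For the upper bound, let the edges of the complete graph on \<open>n + 2k - 2\<close> vertices be
  coloured without a matching of size \<open>k\<close> in colour 1 or in colour 2. In each of these two colours
  at most \<open>k - 1\<close> vertices have degree \<open>2k - 1\<close> or more, since \<open>k\<close> such vertices could be matched
  greedily to \<open>k\<close> further vertices (\<open>contains_matching_if_high_degrees\<close>). Discarding all these
  vertices leaves at least \<open>n\<close> others. Among any \<open>n\<close> of them, a vertex misses at most
  \<open>2 (2k - 2)\<close> of the others in colour 0, so for large \<open>n\<close> the colour 0 degrees are at least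
  \<open>n / 2\<close>, and a Hamiltonian cycle on these \<open>n\<close> vertices exists by Ore's theorem
  (\<open>contains_cycle_if_ore\<close>).

  For the lower bound, take two disjoint sets of \<open>k - 1\<close> vertices, give colour 1 to the edges
  meeting the first, colour 2 to the remaining edges meeting the second, and colour 0 to all
  others. A matching in colour 1 or 2 has at most \<open>k - 1\<close> edges because \<open>k - 1\<close> vertices cover
  that colour (\<open>matching_size_le_cover\<close>), and a cycle in colour 0 has to avoid both sets, so on
  fewer than \<open>n + 2k - 2\<close> vertices it is shorter than \<open>n\<close>.\<close>

section \<open>Neighbourhoods and matchings\<close>

definition neighbours :: "'a graph \<Rightarrow> 'a \<Rightarrow> 'a set" where
  "neighbours G v = {w. {v, w} \<in> edges G}"

lemma simple_graph_edgeD: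
  assumes "simple_graph G" "{v, w} \<in> edges G"
  shows "v \<noteq> w" "v \<in> verts G" "w \<in> verts G"
proof -
  have "{v, w} \<in> [verts G]\<^bsup>2\<^esup>"
    using assms unfolding simple_graph_def by blast
  then have "card {v, w} = 2" "{v, w} \<subseteq> verts G"
    by (simp_all add: nsets_def)
  then show "v \<noteq> w" "v \<in> verts G" "w \<in> verts G"
    by auto
qed

lemma finite_neighbours:
  assumes "simple_graph G"
  shows "finite (neighbours G v)"
proof (rule finite_subset)
  show "neighbours G v \<subseteq> verts G"
    using simple_graph_edgeD [OF assms] by (auto simp: neighbours_def)
  show "finite (verts G)"
    using assms by (simp add: simple_graph_def)
qed

lemma contains_matchingI:
  assumes G: "simple_graph G" and S: "finite S" "card S = k"
    and g: "inj_on g S" "g ` S \<inter> S = {}" "\<And>v. v \<in> S \<Longrightarrow> {v, g v} \<in> edges G"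
  shows "contains_copy G (matching_graph k)"
proof -
  obtain h where h: "bij_betw h {..<k} S"
    using S by (metis card_lessThan finite_lessThan finite_same_card_bij)
  \<comment> \<open>The edge \<open>{2 * i, 2 * i + 1}\<close> goes to the \<open>i\<close>-th vertex of \<open>S\<close> and its partner.\<close>
  define f where "f j = (if even j then h (j div 2) else g (h (j div 2)))" for j
  have hS: "h (j div 2) \<in> S" if "j < 2 * k" for j
  proof -
    have "j div 2 < k"
      using that by auto
    then show ?thesis
      using h by (auto simp: bij_betw_def)
  qed
  have h_eq: "i div 2 = j div 2"
    if "h (i div 2) = h (j div 2)" "i < 2 * k" "j < 2 * k" for i j
  proof -
    have "i div 2 < k" "j div 2 < k"
      using that by auto
    then show ?thesis
      using h that(1) by (auto simp: bij_betw_def inj_on_def)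
  qed
  have "inj_on f {..<2 * k}"
  proof (rule inj_onI)
    fix i j assume "i \<in> {..<2 * k}" "j \<in> {..<2 * k}" and eq: "f i = f j"
    then have ij: "i < 2 * k" "j < 2 * k"
      by auto
    have par: "even i \<longleftrightarrow> even j"
      using eq hS [OF ij(1)] hS [OF ij(2)] g(2) by (fastforce simp: f_def split: if_splits)
    have "h (i div 2) = h (j div 2)"
      using eq par hS [OF ij(1)] hS [OF ij(2)] g(1)
      by (auto simp: f_def inj_on_def split: if_splits)
    then have "i div 2 = j div 2"
      using h_eq ij by blast
    then show "i = j"
      using par by presburger
  qed
  moreover have edge: "{f (2 * i), f (2 * i + 1)} \<in> edges G" if "i < k" for i
    using g(3) [OF hS [of "2 * i"]] that by (simp add: f_def)
  moreover have "f j \<in> verts G" if "j < 2 * k" for j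
    using simple_graph_edgeD [OF G g(3) [OF hS [OF that]]] by (simp add: f_def)
  ultimately show ?thesis
    unfolding contains_copy_def matching_graph_def by (intro exI [of _ f]) auto
qed

text \<open>The partners are chosen greedily: a vertex of \<open>S\<close> loses at most the \<open>k - 1\<close> other
  vertices of \<open>S\<close> and at most \<open>k - 1\<close> earlier partners among its \<open>2k - 1\<close> neighbours.\<close>

lemma contains_matching_if_high_degrees:
  assumes G: "simple_graph G" and S: "finite S" "card S = k"
    and deg: "\<And>v. v \<in> S \<Longrightarrow> 2 * k \<le> card (neighbours G v) + 1"
  shows "contains_copy G (matching_graph k)"
proof -
  have "\<exists>g. inj_on g T \<and> g ` T \<inter> S = {} \<and> (\<forall>v \<in> T. {v, g v} \<in> edges G)" if "T \<subseteq> S" for T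
    using finite_subset [OF that S(1)] that
  proof (induction T rule: finite_induct)
    case empty
    then show ?case by auto
  next
    case (insert x T)
    then obtain g where g: "inj_on g T" "g ` T \<inter> S = {}" "\<forall>v \<in> T. {v, g v} \<in> edges G"
      by auto
    have xS: "x \<in> S" and TS: "T \<subseteq> S - {x}"
      using insert by auto
    have "card T \<le> k - 1"
      using card_mono [OF _ TS] S xS by simp
    then have "card (g ` T) \<le> k - 1"
      using card_image_le [OF insert.hyps(1), of g] by linarith
    moreover have "card (S - {x}) = k - 1"
      using S xS by simp
    moreover have "k > 0"
      using S xS card_gt_0_iff by blast
    ultimately have "card ((S - {x}) \<union> g ` T) < card (neighbours G x)"
      using card_Un_le [of "S - {x}" "g ` T"] deg [OF xS] by linarith
    then have "\<not> neighbours G x \<subseteq> (S - {x}) \<union> g ` T"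
      using card_mono [of "(S - {x}) \<union> g ` T" "neighbours G x"] S(1) insert.hyps(1) by auto
    then obtain y where y: "y \<in> neighbours G x" "y \<notin> S - {x}" "y \<notin> g ` T"
      by blast
    then have xy: "{x, y} \<in> edges G"
      by (simp add: neighbours_def)
    then have "y \<notin> S"
      using y simple_graph_edgeD(1) [OF G] by auto
    then show ?case
      using g y xy insert.hyps(2)
      by (intro exI [of _ "g(x := y)"]) (auto simp: inj_on_def fun_upd_def)
  qed
  from this [OF order_refl] show ?thesis
    using contains_matchingI [OF G S] by blast
qed

lemma matching_size_le_cover:
  assumes copy: "contains_copy G (matching_graph k)" and A: "finite A"
    and cover: "\<And>e. e \<in> edges G \<Longrightarrow> e \<inter> A \<noteq> {}"
  shows "k \<le> card A"
proof -
  obtain f where f: "inj_on f {..<2 * k}"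
    and f_edges: "\<forall>e \<in> edges (matching_graph k). f ` e \<in> edges G"
    using copy by (auto simp: contains_copy_def matching_graph_def)
  have edge: "f ` {2 * i, 2 * i + 1} \<in> edges G" if "i < k" for i
    using that by (intro bspec [OF f_edges]) (auto simp: matching_graph_def)
  have "\<exists>j. j < 2 * k \<and> j div 2 = i \<and> f j \<in> A" if "i < k" for i
  proof -
    have "f (2 * i) \<in> A \<or> f (2 * i + 1) \<in> A"
      using cover [OF edge [OF that]] by auto
    then show ?thesis
    proof
      assume "f (2 * i) \<in> A"
      then show ?thesis
        using that by (intro exI [of _ "2 * i"]) auto
    next
      assume "f (2 * i + 1) \<in> A"
      then show ?thesis
        using that by (intro exI [of _ "2 * i + 1"]) auto
    qed
  qed
  then obtain j where j: "\<And>i. i < k \<Longrightarrow> j i < 2 * k \<and> j i div 2 = i \<and> f (j i) \<in> A"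
    by metis
  have "inj_on (\<lambda>i. f (j i)) {..<k}"
  proof (rule inj_onI)
    fix i i' assume i: "i \<in> {..<k}" "i' \<in> {..<k}" "f (j i) = f (j i')"
    then have "j i = j i'"
      using f j by (auto simp: inj_on_def)
    then show "i = i'"
      using j i by (metis lessThan_iff)
  qed
  moreover have "(\<lambda>i. f (j i)) ` {..<k} \<subseteq> A"
    using j by auto
  ultimately show ?thesis
    using card_inj_on_le [OF _ _ A] by fastforce
qed

section \<open>Ore's theorem\<close>

text \<open>Cyclic arrangements of the vertices are represented by lists, and compared by the number of
  places where consecutive vertices are not adjacent.\<close>

definition gap :: "'a graph \<Rightarrow> 'a \<Rightarrow> 'a \<Rightarrow> nat" where
  "gap G x y = (if {x, y} \<in> edges G then 0 else 1)"

fun path_gaps :: "'a graph \<Rightarrow> 'a list \<Rightarrow> nat" where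
  "path_gaps G (x # y # zs) = gap G x y + path_gaps G (y # zs)"
| "path_gaps G _ = 0"

definition cycle_gaps :: "'a graph \<Rightarrow> 'a list \<Rightarrow> nat" where
  "cycle_gaps G xs = path_gaps G xs + gap G (last xs) (hd xs)"

lemma gap_commute: "gap G x y = gap G y x"
  by (simp add: gap_def insert_commute)

lemma path_gaps_append:
  assumes "us \<noteq> []" "vs \<noteq> []"
  shows "path_gaps G (us @ vs) = path_gaps G us + gap G (last us) (hd vs) + path_gaps G vs"
  using assms
proof (induction G us rule: path_gaps.induct)
  case ("2_2" G v)
  then show ?case by (cases vs) auto
qed auto

lemma path_gaps_rev: "path_gaps G (rev xs) = path_gaps G xs"
proof (induction G xs rule: path_gaps.induct)
  case (1 G x y zs)
  then show ?case
    using path_gaps_append [of "rev (y # zs)" "[x]" G] by (simp add: gap_commute)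
qed auto

lemma cycle_gaps_append:
  assumes "us \<noteq> []" "vs \<noteq> []"
  shows "cycle_gaps G (us @ vs) =
    path_gaps G us + path_gaps G vs + gap G (last us) (hd vs) + gap G (last vs) (hd us)"
  using assms by (simp add: cycle_gaps_def path_gaps_append)

lemma path_gaps_zeroD:
  assumes "path_gaps G xs = 0" "Suc i < length xs"
  shows "{xs ! i, xs ! Suc i} \<in> edges G"
  using assms
proof (induction G xs arbitrary: i rule: path_gaps.induct)
  case (1 G x y zs)
  then show ?case
    by (cases i) (auto simp: gap_def split: if_splits)
qed auto

lemma path_gaps_posD:
  assumes "path_gaps G xs > 0"
  shows "\<exists>us vs. xs = us @ vs \<and> us \<noteq> [] \<and> vs \<noteq> [] \<and> {last us, hd vs} \<notin> edges G"
  using assms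
proof (induction G xs rule: path_gaps.induct)
  case (1 G x y zs)
  show ?case
  proof (cases "{x, y} \<in> edges G")
    case True
    then obtain us vs where "y # zs = us @ vs" "us \<noteq> []" "vs \<noteq> []" "{last us, hd vs} \<notin> edges G"
      using 1 by (auto simp: gap_def)
    then show ?thesis
      by (intro exI [of _ "x # us"] exI [of _ vs]) auto
  next
    case False
    then show ?thesis
      by (intro exI [of _ "[x]"] exI [of _ "y # zs"]) auto
  qed
qed auto

text \<open>A gap can be moved to the place between the last and the first vertex by rotation.\<close>

lemma rotate_gap_to_end:
  assumes "cycle_gaps G xs > 0"
  obtains ys where "mset ys = mset xs" "cycle_gaps G ys = cycle_gaps G xs"
    "{last ys, hd ys} \<notin> edges G"
proof (cases "path_gaps G xs = 0")
  case True
  then have "{last xs, hd xs} \<notin> edges G"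
    using assms by (auto simp: cycle_gaps_def gap_def)
  then show ?thesis
    using that by blast
next
  case False
  then obtain us vs where uv: "xs = us @ vs" "us \<noteq> []" "vs \<noteq> []" "{last us, hd vs} \<notin> edges G"
    using path_gaps_posD by blast
  show ?thesis
  proof (rule that [of "vs @ us"])
    show "cycle_gaps G (vs @ us) = cycle_gaps G xs"
      using uv by (simp add: cycle_gaps_append)
  qed (use uv in auto)
qed

text \<open>The exchange step: if the last vertex \<open>b\<close> and the first vertex \<open>a\<close> are not adjacent, Ore's
  condition and the pigeonhole principle give consecutive vertices \<open>x\<close>, \<open>y\<close> with \<open>b\<close> adjacent to
  \<open>x\<close> and \<open>a\<close> adjacent to \<open>y\<close>. Reversing the segment from \<open>a\<close> to \<open>x\<close> replaces the neighbouring
  pairs \<open>x, y\<close> and \<open>b, a\<close> by \<open>a, y\<close> and \<open>b, x\<close>, and so closes a gap without opening one.\<close>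

lemma fewer_gaps_if_ore:
  assumes G: "simple_graph G" and xs: "distinct xs" "length xs \<ge> 2"
    and gap: "{last xs, hd xs} \<notin> edges G"
    and ore: "length xs \<le> card (neighbours G (last xs) \<inter> set xs)
      + card (neighbours G (hd xs) \<inter> set xs)"
  obtains ys where "mset ys = mset xs" "cycle_gaps G ys < cycle_gaps G xs"
proof -
  define m where "m = length xs - 1"
  have m: "length xs = Suc m"
    using xs by (simp add: m_def)
  have last: "last xs = xs ! m" and hd: "hd xs = xs ! 0"
    using m last_conv_nth [of xs] hd_conv_nth [of xs] by fastforce+
  define A where "A = {i. i < m \<and> {last xs, xs ! i} \<in> edges G}"
  define B where "B = {i. i < m \<and> {hd xs, xs ! Suc i} \<in> edges G}"
  have fin: "finite A" "finite B"
    by (auto simp: A_def B_def)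
  have "neighbours G (last xs) \<inter> set xs \<subseteq> (\<lambda>i. xs ! i) ` A"
  proof
    fix w assume w: "w \<in> neighbours G (last xs) \<inter> set xs"
    then obtain i where i: "i < Suc m" "w = xs ! i"
      using m by (metis IntD2 in_set_conv_nth)
    have "i \<noteq> m"
      using w i last simple_graph_edgeD(1) [OF G, of "last xs" w] by (auto simp: neighbours_def)
    then show "w \<in> (\<lambda>i. xs ! i) ` A"
      using w i by (auto simp: A_def neighbours_def)
  qed
  then have cardA: "card (neighbours G (last xs) \<inter> set xs) \<le> card A"
    using fin by (simp add: surj_card_le)
  have "neighbours G (hd xs) \<inter> set xs \<subseteq> (\<lambda>i. xs ! Suc i) ` B"
  proof
    fix w assume w: "w \<in> neighbours G (hd xs) \<inter> set xs"
    then obtain i where i: "i < Suc m" "w = xs ! i"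
      using m by (metis IntD2 in_set_conv_nth)
    have "i \<noteq> 0"
      using w i hd simple_graph_edgeD(1) [OF G, of "hd xs" w]
      by (metis IntD1 mem_Collect_eq neighbours_def)
    then obtain i' where "i = Suc i'"
      by (cases i) auto
    then show "w \<in> (\<lambda>i. xs ! Suc i) ` B"
      using w i by (auto simp: B_def neighbours_def)
  qed
  then have cardB: "card (neighbours G (hd xs) \<inter> set xs) \<le> card B"
    using fin by (simp add: surj_card_le)
  have "card (A \<union> B) \<le> card {..<m}"
    by (rule card_mono) (auto simp: A_def B_def)
  then have "card (A \<inter> B) > 0"
    using card_Un_Int [OF fin] cardA cardB ore m by simp
  then obtain i where i: "i < m" "{last xs, xs ! i} \<in> edges G" "{hd xs, xs ! Suc i} \<in> edges G"
    by (auto simp: A_def B_def card_gt_0_iff)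
  define us vs where "us = take (Suc i) xs" and "vs = drop (Suc i) xs"
  have uv: "xs = us @ vs" "us \<noteq> []" "vs \<noteq> []"
    using i m by (auto simp: us_def vs_def)
  have ends: "last us = xs ! i" "hd vs = xs ! Suc i" "hd us = hd xs" "last vs = last xs"
    using i(1) m uv(2,3)
    by (simp_all add: us_def vs_def last_conv_nth hd_drop_conv_nth)
  show ?thesis
  proof (rule that [of "rev us @ vs"])
    have "cycle_gaps G (rev us @ vs) = path_gaps G us + path_gaps G vs"
      using uv(2,3) i(2,3)
      by (simp add: cycle_gaps_append path_gaps_rev hd_rev last_rev ends gap_def)
    moreover have "cycle_gaps G xs \<ge> path_gaps G us + path_gaps G vs + 1"
      using cycle_gaps_append [OF uv(2,3), of G] gap unfolding uv(1) [symmetric] ends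
      by (simp add: gap_def)
    ultimately show "cycle_gaps G (rev us @ vs) < cycle_gaps G xs"
      by simp
    show "mset (rev us @ vs) = mset xs"
      by (simp add: uv(1))
  qed
qed

lemma contains_cycle_if_no_gaps:
  assumes xs: "distinct xs" "set xs \<subseteq> verts G" and no_gaps: "cycle_gaps G xs = 0"
  shows "contains_copy G (cycle_graph (length xs))"
proof -
  have "{xs ! i, xs ! ((i + 1) mod length xs)} \<in> edges G" if i: "i < length xs" for i
  proof (cases "Suc i = length xs")
    case True
    have "{last xs, hd xs} \<in> edges G"
      using no_gaps by (auto simp: cycle_gaps_def gap_def split: if_splits)
    moreover have "last xs = xs ! i" "hd xs = xs ! 0"
      using last_conv_nth [of xs] hd_conv_nth [of xs] arg_cong [OF True, of "\<lambda>l. l - 1"] i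
      by fastforce+
    ultimately show ?thesis
      using True by simp
  next
    case False
    then show ?thesis
      using path_gaps_zeroD [of G xs i] no_gaps i by (simp add: cycle_gaps_def)
  qed
  then show ?thesis
    using xs unfolding contains_copy_def cycle_graph_def
    by (intro exI [of _ "(!) xs"]) (auto simp: inj_on_nth)
qed

text \<open>An arrangement with the least number of gaps has none, by the exchange step.\<close>

theorem contains_cycle_if_ore:
  assumes G: "simple_graph G" and W: "W \<subseteq> verts G" "card W \<ge> 3"
    and ore: "\<And>u v. \<lbrakk>u \<in> W; v \<in> W; u \<noteq> v; {u, v} \<notin> edges G\<rbrakk>
      \<Longrightarrow> card W \<le> card (neighbours G u \<inter> W) + card (neighbours G v \<inter> W)"
  shows "contains_copy G (cycle_graph (card W))"
proof -
  define P where "P xs \<longleftrightarrow> distinct xs \<and> set xs = W" for xs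
  have P_mset: "P ys" if "P xs" "mset ys = mset xs" for xs ys
    using that unfolding P_def by (metis mset_eq_imp_distinct_iff mset_eq_setD)
  have "finite W"
    using W card.infinite by fastforce
  then obtain xs0 where "P xs0"
    unfolding P_def using finite_distinct_list by blast
  then obtain xs where xs: "P xs" and least: "\<And>ys. P ys \<Longrightarrow> cycle_gaps G xs \<le> cycle_gaps G ys"
    using ex_has_least_nat [of P xs0 "cycle_gaps G"] by blast
  have "cycle_gaps G xs = 0"
  proof (rule ccontr)
    assume "cycle_gaps G xs \<noteq> 0"
    then obtain ys where ys: "mset ys = mset xs" "cycle_gaps G ys = cycle_gaps G xs"
      "{last ys, hd ys} \<notin> edges G"
      using rotate_gap_to_end by blast
    have d: "distinct ys" "set ys = W"
      using P_mset [OF xs ys(1)] by (auto simp: P_def)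
    then have len: "length ys = card W"
      by (metis distinct_card)
    then have ne: "ys \<noteq> []" "length ys \<ge> 2"
      using W by auto
    have "last ys \<noteq> hd ys"
      using d(1) ne by (cases ys) (auto split: if_splits)
    moreover have "last ys \<in> W" "hd ys \<in> W"
      using d ne by auto
    ultimately have "length ys \<le> card (neighbours G (last ys) \<inter> set ys)
        + card (neighbours G (hd ys) \<inter> set ys)"
      using ore ys(3) len d(2) by simp
    then obtain zs where "mset zs = mset ys" "cycle_gaps G zs < cycle_gaps G ys"
      using fewer_gaps_if_ore [OF G d(1) ne(2) ys(3)] by blast
    then show False
      using least [OF P_mset [OF xs]] ys by fastforce
  qed
  then show ?thesis
    using contains_cycle_if_no_gaps [of xs G] xs W(1) by (simp add: P_def) (metis distinct_card)
qed

section \<open>The Ramsey number\<close>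

lemma simple_graph_colour_class:
  "simple_graph G \<Longrightarrow> simple_graph (colour_class G c i)"
  by (auto simp: simple_graph_def colour_class_def)

lemma few_high_degrees:
  assumes G: "simple_graph G" and k: "k \<ge> 1" and no: "\<not> contains_copy G (matching_graph k)"
  shows "card {v \<in> verts G. 2 * k \<le> card (neighbours G v) + 1} \<le> k - 1"
proof (rule ccontr)
  let ?S = "{v \<in> verts G. 2 * k \<le> card (neighbours G v) + 1}"
  assume "\<not> card ?S \<le> k - 1"
  then have "k \<le> card ?S"
    by simp
  then obtain S where "S \<subseteq> ?S" "card S = k" "finite S"
    by (rule obtain_subset_with_card_n)
  then show False
    using contains_matching_if_high_degrees [OF G, of S k] no by blast
qed

lemma ramsey_upper:
  fixes n k :: nat
  assumes k: "k \<ge> 1" and n: "n \<ge> 8 * k"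
  shows "ramsey_arrows (n + 2 * k - 2) [cycle_graph n, matching_graph k, matching_graph k]"
  unfolding ramsey_arrows_def
proof (rule ballI, rule ccontr)
  let ?Gs = "[cycle_graph n, matching_graph k, matching_graph k]"
  define K where "K = complete_graph (n + 2 * k - 2)"
  fix c
  assume "c \<in> edges (complete_graph (n + 2 * k - 2)) \<rightarrow> {..<length ?Gs}"
    and "\<not> (\<exists>i < length ?Gs.
      contains_copy (colour_class (complete_graph (n + 2 * k - 2)) c i) (?Gs ! i))"
  then have c: "\<And>e. e \<in> edges K \<Longrightarrow> c e < 3"
    and no: "\<And>i. i < 3 \<Longrightarrow> \<not> contains_copy (colour_class K c i) (?Gs ! i)"
    by (auto simp: K_def numeral_3_eq_3)
  define G where "G = colour_class K c"
  have simple: "simple_graph (G i)" for i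
    unfolding G_def K_def by (intro simple_graph_colour_class simple_graph_complete_graph)
  have verts: "verts (G i) = {..<n + 2 * k - 2}" for i
    by (simp add: G_def colour_class_def K_def complete_graph_def)
  have no': "\<not> contains_copy (G 0) (cycle_graph n)"
    "\<not> contains_copy (G 1) (matching_graph k)" "\<not> contains_copy (G 2) (matching_graph k)"
    using no [of 0] no [of 1] no [of 2] by (simp_all add: G_def)
  define S where "S i = {v \<in> verts (G i). 2 * k \<le> card (neighbours (G i) v) + 1}" for i
  have S: "card (S 1) \<le> k - 1" "card (S 2) \<le> k - 1"
    unfolding S_def using few_high_degrees [OF simple k] no' by auto
  have "n \<le> card ({..<n + 2 * k - 2} - (S 1 \<union> S 2))"
  proof -
    have "card (S 1 \<union> S 2) \<le> 2 * k - 2"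
      using card_Un_le [of "S 1" "S 2"] S by linarith
    moreover have "card {..<n + 2 * k - 2} - card (S 1 \<union> S 2)
        \<le> card ({..<n + 2 * k - 2} - (S 1 \<union> S 2))"
      by (rule diff_card_le_card_Diff) (simp add: S_def verts)
    ultimately show ?thesis
      using k by simp
  qed
  then obtain W where W: "W \<subseteq> {..<n + 2 * k - 2} - (S 1 \<union> S 2)" "card W = n" "finite W"
    by (rule obtain_subset_with_card_n)
  \<comment> \<open>A vertex of \<open>W\<close> keeps at least \<open>n - 1 - 2 * (2 * k - 2)\<close> neighbours in colour 0, which is
    \<open>n / 2\<close> or more once \<open>n\<close> is at least \<open>8 * k - 6\<close>.\<close>
  have deg: "n \<le> 2 * card (neighbours (G 0) v \<inter> W)" if v: "v \<in> W" for v
  proof -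
    have low: "card (neighbours (G i) v) \<le> 2 * k - 2" if "i = 1 \<or> i = 2" for i
      using that v W(1) by (auto simp: S_def verts)
    have "W \<subseteq> insert v (neighbours (G 1) v \<union> neighbours (G 2) v \<union> (neighbours (G 0) v \<inter> W))"
    proof
      fix w assume w: "w \<in> W"
      show "w \<in> insert v (neighbours (G 1) v \<union> neighbours (G 2) v \<union> (neighbours (G 0) v \<inter> W))"
      proof (cases "w = v")
        case False
        then have e: "{v, w} \<in> edges K"
          using v w W(1) by (auto simp: K_def complete_graph_def nsets_def)
        then have "c {v, w} = 0 \<or> c {v, w} = 1 \<or> c {v, w} = 2"
          using c [OF e] by linarith
        then show ?thesis
          using e w by (auto simp: neighbours_def G_def colour_class_def)
      qed simp
    qed
    from card_mono [OF _ this] have "n \<le> card (insert v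
        (neighbours (G 1) v \<union> neighbours (G 2) v \<union> (neighbours (G 0) v \<inter> W)))"
      using W(2) finite_neighbours [OF simple] by simp
    also have "\<dots> \<le> Suc (card (neighbours (G 1) v \<union> neighbours (G 2) v
        \<union> (neighbours (G 0) v \<inter> W)))"
      by (rule card_insert_le_m1) auto
    also have "\<dots> \<le> Suc (card (neighbours (G 1) v) + card (neighbours (G 2) v)
        + card (neighbours (G 0) v \<inter> W))"
      using card_Un_le [of "neighbours (G 1) v \<union> neighbours (G 2) v" "neighbours (G 0) v \<inter> W"]
        card_Un_le [of "neighbours (G 1) v" "neighbours (G 2) v"] by linarith
    finally show ?thesis
      using low [of 1] low [of 2] n k by simp
  qed
  have "contains_copy (G 0) (cycle_graph (card W))"
  proof (rule contains_cycle_if_ore [OF simple])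
    show "W \<subseteq> verts (G 0)" "card W \<ge> 3"
      using W n k by (auto simp: verts)
    show "card W \<le> card (neighbours (G 0) u \<inter> W) + card (neighbours (G 0) v \<inter> W)"
      if "u \<in> W" "v \<in> W" for u v
      using deg [OF that(1)] deg [OF that(2)] W(2) by linarith
  qed
  then show False
    using no'(1) W(2) by simp
qed

lemma ramsey_lower:
  fixes n k m :: nat
  assumes k: "k \<ge> 1" and n: "n \<ge> 1"
    and arrows: "ramsey_arrows m [cycle_graph n, matching_graph k, matching_graph k]"
  shows "n + 2 * k - 2 \<le> m"
proof -
  let ?Gs = "[cycle_graph n, matching_graph k, matching_graph k]"
  define A B where "A = {..<k - 1}" and "B = {k - 1..<2 * k - 2}"
  define c :: "nat set \<Rightarrow> nat"
    where "c e = (if e \<inter> A \<noteq> {} then 1 else if e \<inter> B \<noteq> {} then 2 else 0)" for e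
  have c: "c \<in> edges (complete_graph m) \<rightarrow> {..<length ?Gs}"
    by (auto simp: c_def)
  define G where "G = colour_class (complete_graph m) c"
  have "\<exists>i < length ?Gs. contains_copy (G i) (?Gs ! i)"
    using arrows c unfolding ramsey_arrows_def G_def by blast
  then have "contains_copy (G 0) (cycle_graph n) \<or> contains_copy (G 1) (matching_graph k)
      \<or> contains_copy (G 2) (matching_graph k)"
    by (auto simp: less_Suc_eq numeral_2_eq_2)
  moreover have "\<not> contains_copy (G 1) (matching_graph k)"
  proof
    assume "contains_copy (G 1) (matching_graph k)"
    moreover have "e \<inter> A \<noteq> {}" if "e \<in> edges (G 1)" for e
    proof -
      have "c e = 1"
        using that by (simp add: G_def colour_class_def)
      then show ?thesis
        by (simp add: c_def split: if_splits)
    qed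
    moreover have "finite A"
      by (simp add: A_def)
    ultimately have "k \<le> card A"
      using matching_size_le_cover by blast
    then show False
      using k by (simp add: A_def)
  qed
  moreover have "\<not> contains_copy (G 2) (matching_graph k)"
  proof
    assume "contains_copy (G 2) (matching_graph k)"
    moreover have "e \<inter> B \<noteq> {}" if "e \<in> edges (G 2)" for e
    proof -
      have "c e = 2"
        using that by (simp add: G_def colour_class_def)
      then show ?thesis
        by (simp add: c_def split: if_splits)
    qed
    moreover have "finite B"
      by (simp add: B_def)
    ultimately have "k \<le> card B"
      using matching_size_le_cover by blast
    then show False
      using k by (simp add: B_def)
  qed
  ultimately have "contains_copy (G 0) (cycle_graph n)"
    by blast
  then obtain f where f: "inj_on f {..<n}" "f ` {..<n} \<subseteq> {..<m}"
    and f_edges: "\<forall>e \<in> edges (cycle_graph n). f ` e \<in> edges (G 0)"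
    by (auto simp: contains_copy_def cycle_graph_def G_def colour_class_def complete_graph_def)
  have edge: "f ` {i, (i + 1) mod n} \<in> edges (G 0)" if "i < n" for i
    using that by (intro bspec [OF f_edges]) (auto simp: cycle_graph_def)
  have "f i \<in> {2 * k - 2..<m}" if "i < n" for i
  proof -
    have "c (f ` {i, (i + 1) mod n}) = 0"
      using edge [OF that] by (simp add: G_def colour_class_def)
    then have "f ` {i, (i + 1) mod n} \<inter> (A \<union> B) = {}"
      by (simp add: c_def Int_Un_distrib split: if_splits)
    then have "f i \<notin> A \<union> B"
      by blast
    then show ?thesis
      using f(2) that by (auto simp: A_def B_def)
  qed
  then have "f ` {..<n} \<subseteq> {2 * k - 2..<m}"
    by auto
  then have "n \<le> m - (2 * k - 2)"
    using card_inj_on_le [OF f(1), of "{2 * k - 2..<m}"] by simp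
  then show ?thesis
    using n k by linarith
qed

theorem theorem17:
  fixes k :: nat
  assumes "k \<ge> 1"
  shows "\<exists>N. \<forall>n \<ge> N.
    ramsey_number [cycle_graph n, matching_graph k, matching_graph k] = n + 2 * k - 2"
proof (intro exI [of _ "8 * k"] allI impI)
  fix n assume "8 * k \<le> n"
  then show "ramsey_number [cycle_graph n, matching_graph k, matching_graph k] = n + 2 * k - 2"
    unfolding ramsey_number_def
    using ramsey_upper [OF assms] ramsey_lower [OF assms] assms by (intro Least_equality) auto
qed

end
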